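(* Let $(S_n)$ be the elephant random walk with memory parameter $p\in[0,1]$ and first-step parameter $q\in[0,1]$, and let $V_n=4\sum_{k=1}^{n-1}(S_k/k)^2$. For any $0<\alpha<1$ and all $n\ge2$, an exact confidence interval for $p$ with confidence level $1-\alpha$ is given by $$\mathcal{J}(p)=\Bigl[\widehat{p}_n-\frac{2\sqrt{3n\log(2/\alpha)}}{V_n},\ \ \widehat{p}_n+\frac{2\sqrt{3n\log(2/\alpha)}}{V_n}\Bigr],$$ that is, $\mathbb{P}(p\in\mathcal{J}(p))\ge1-\alpha$. Moreover, in the diffusive regime with $1/4\le p<3/4$, the exact confidence interval $\mathcal{J}(p)$ can be slightly improved by $$\mathcal{K}(p)=\Bigl[\widehat{p}_n-\frac{\sqrt{29n\log(2/\alpha)}}{\sqrt3\,V_n},\ \ \widehat{p}_n+\frac{\sqrt{29n\log(2/\alpha)}}{\sqrt3\,V_n}\Bigr],$$ that is, $\mathbb{P}(p\in\mathcal{K}(p))\ge1-\alpha$.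
   Context: Elephant random walk (ERW): fix $q\in[0,1]$ and $p\in[0,1]$. Set $S_0=0$. The first step $X_1$ equals $+1$ with probability $q$ and $-1$ with probability $1-q$. For each $n\ge 1$, an integer $k$ is chosen uniformly at random among $1,\dots,n$ (independently of the past), and $X_{n+1}=X_k$ with probability $p$, $X_{n+1}=-X_k$ with probability $1-p$. The position is $S_{n+1}=S_n+X_{n+1}$, so $S_n=X_1+\cdots+X_n$. Equivalently, with $\mathcal{F}_n=\sigma(X_1,\dots,X_n)$, $\mathbb{P}(X_{n+1}=1\mid\mathcal{F}_n)=\frac12\bigl(1+(2p-1)\frac{S_n}{n}\bigr)$ and $\mathbb{P}(X_{n+1}=-1\mid\mathcal{F}_n)=\frac12\bigl(1-(2p-1)\frac{S_n}{n}\bigr)$ for all $n\ge1$. Estimator: for all $n\ge2$, $$\widehat{p}_n=\frac{\sum_{k=1}^{n-1}\frac{S_k}{k}\bigl(X_{k+1}+\frac{S_k}{k}\bigr)}{2\sum_{k=1}^{n-1}\bigl(\frac{S_k}{k}\bigr)^2}.$$ An exact (non-asymptotic) confidence interval with confidence level $1-\alpha$ is a random interval which contains $p$ with probability at least $1-\alpha$. *)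

theory Defs
  imports "HOL-Probability.Probability"
begin

text \<open>
  The sigma-algebra generated by a random variable. Independence is stated through it because
  \<open>indep_var\<close> forces both variables to have the same type.
\<close>

definition gen_sigma :: "'a measure \<Rightarrow> 'b measure \<Rightarrow> ('a \<Rightarrow> 'b) \<Rightarrow> 'a set set" where
  "gen_sigma M N f = sets (vimage_algebra (space M) f N)"

text \<open>
  The steps are \<open>X 1, X 2, \<dots>\<close>; the value \<open>X 0\<close> plays no role. At time \<open>n \<ge> 1\<close> the elephant
  recalls the step with the random index \<open>K n\<close>, and repeats it if \<open>B n\<close> holds and reverses it
  otherwise. Independence of the past means independence of the steps \<open>X 1, \<dots>, X n\<close>.
  All distributional requirements are almost sure ones, e.g. \<open>K n\<close> lies in \<open>{1..n}\<close> and \<open>X n\<close> in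
  \<open>{-1, 1}\<close> up to null events.
\<close>

locale elephant_random_walk = prob_space M for M :: "'a measure" +
  fixes q p :: real
    and X :: "nat \<Rightarrow> 'a \<Rightarrow> real"
    and K :: "nat \<Rightarrow> 'a \<Rightarrow> nat"
    and B :: "nat \<Rightarrow> 'a \<Rightarrow> bool"
  assumes q_range: "q \<in> {0..1}"
    and p_range: "p \<in> {0..1}"
    and X_measurable: "\<And>n. n \<ge> 1 \<Longrightarrow> random_variable borel (X n)"
    and K_measurable: "\<And>n. n \<ge> 1 \<Longrightarrow> random_variable (count_space UNIV) (K n)"
    and B_measurable: "\<And>n. n \<ge> 1 \<Longrightarrow> random_variable (count_space UNIV) (B n)"
    and first_step_plus: "prob {\<omega> \<in> space M. X 1 \<omega> = 1} = q"
    and first_step_minus: "prob {\<omega> \<in> space M. X 1 \<omega> = -1} = 1 - q"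
    and K_uniform: "\<And>n k. n \<ge> 1 \<Longrightarrow> k \<in> {1..n} \<Longrightarrow> prob {\<omega> \<in> space M. K n \<omega> = k} = 1 / real n"
    and B_bernoulli: "\<And>n. n \<ge> 1 \<Longrightarrow> prob {\<omega> \<in> space M. B n \<omega>} = p"
    and indep_K_B: "\<And>n. n \<ge> 1 \<Longrightarrow>
      indep_set (gen_sigma M (count_space UNIV) (K n)) (gen_sigma M (count_space UNIV) (B n))"
    and indep_past: "\<And>n. n \<ge> 1 \<Longrightarrow>
      indep_set
        (gen_sigma M (PiM {1..n} (\<lambda>_. borel)) (\<lambda>\<omega>. \<lambda>i\<in>{1..n}. X i \<omega>))
        (gen_sigma M (count_space UNIV \<Otimes>\<^sub>M count_space UNIV) (\<lambda>\<omega>. (K n \<omega>, B n \<omega>)))"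
    and step: "\<And>n. n \<ge> 1 \<Longrightarrow>
      AE \<omega> in M. X (n + 1) \<omega> = (if B n \<omega> then X (K n \<omega>) \<omega> else - X (K n \<omega>) \<omega>)"

definition erw_S :: "(nat \<Rightarrow> 'a \<Rightarrow> real) \<Rightarrow> nat \<Rightarrow> 'a \<Rightarrow> real" where
  "erw_S X n \<omega> = (\<Sum>i=1..n. X i \<omega>)"

definition erw_p_hat :: "(nat \<Rightarrow> 'a \<Rightarrow> real) \<Rightarrow> nat \<Rightarrow> 'a \<Rightarrow> real" where
  "erw_p_hat X n \<omega> =
    (\<Sum>k=1..n-1. erw_S X k \<omega> / real k * (X (k + 1) \<omega> + erw_S X k \<omega> / real k)) /
    (2 * (\<Sum>k=1..n-1. (erw_S X k \<omega> / real k)\<^sup>2))"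

definition erw_V :: "(nat \<Rightarrow> 'a \<Rightarrow> real) \<Rightarrow> nat \<Rightarrow> 'a \<Rightarrow> real" where
  "erw_V X n \<omega> = 4 * (\<Sum>k=1..n-1. (erw_S X k \<omega> / real k)\<^sup>2)"

definition erw_J :: "(nat \<Rightarrow> 'a \<Rightarrow> real) \<Rightarrow> nat \<Rightarrow> real \<Rightarrow> 'a \<Rightarrow> real set" where
  "erw_J X n \<alpha> \<omega> =
    {erw_p_hat X n \<omega> - 2 * sqrt (3 * real n * ln (2 / \<alpha>)) / erw_V X n \<omega> ..
     erw_p_hat X n \<omega> + 2 * sqrt (3 * real n * ln (2 / \<alpha>)) / erw_V X n \<omega>}"

definition erw_K :: "(nat \<Rightarrow> 'a \<Rightarrow> real) \<Rightarrow> nat \<Rightarrow> real \<Rightarrow> 'a \<Rightarrow> real set" where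
  "erw_K X n \<alpha> \<omega> =
    {erw_p_hat X n \<omega> - sqrt (29 * real n * ln (2 / \<alpha>)) / (sqrt 3 * erw_V X n \<omega>) ..
     erw_p_hat X n \<omega> + sqrt (29 * real n * ln (2 / \<alpha>)) / (sqrt 3 * erw_V X n \<omega>)}"

text \<open>A random interval is an interval whose end points are random variables.\<close>

definition exact_confidence_interval ::
  "'a measure \<Rightarrow> real \<Rightarrow> real \<Rightarrow> ('a \<Rightarrow> real set) \<Rightarrow> bool" where
  "exact_confidence_interval M \<theta> c I \<longleftrightarrow>
    (\<exists>L \<in> borel_measurable M. \<exists>U \<in> borel_measurable M. \<forall>\<omega> \<in> space M. I \<omega> = {L \<omega>..U \<omega>}) \<and>
    measure M {\<omega> \<in> space M. \<theta> \<in> I \<omega>} \<ge> c"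

end

theory Submission imports Defs
begin

text \<open>
  Put \<open>a = 2p - 1\<close>. The estimation error equals \<open>2 D\<^sub>n / V\<^sub>n\<close>, where
  \<open>D\<^sub>n = (\<Sum>k<n. S\<^sub>k/k * (X\<^sub>k\<^sub>+\<^sub>1 - a S\<^sub>k/k))\<close> is a martingale. Given the past, the step
  \<open>X\<^sub>k\<^sub>+\<^sub>1\<close> is a sign with mean \<open>a S\<^sub>k/k\<close>, so Hoeffding's lemma and \<open>\<bar>S\<^sub>k/k\<bar> \<le> 1\<close> bound the
  exponential moment of each increment at \<open>t\<close> by \<open>exp (t\<^sup>2/2)\<close>. The Chernoff bound then gives
  \<open>P (\<bar>D\<^sub>n\<bar> \<ge> x) \<le> 2 exp (- x\<^sup>2/(2n))\<close>, so that any half-width \<open>r / V\<^sub>n\<close> with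
  \<open>r\<^sup>2 \<ge> 8 n ln (2/\<alpha>)\<close> has level \<open>1 - \<alpha>\<close>. Both intervals satisfy this,
  as \<open>8 \<le> 29/3 \<le> 12\<close>.
\<close>

section \<open>Hoeffding's lemma for a sign with given mean\<close>

text \<open>This is \<open>Hoeffdings_lemma_aux\<close> at \<open>2 * u\<close> and
  \<open>r\<close>, exponentiated: \<open>r\<close> is the mass at 1, and 2 is the distance between
  the two points. Negative \<open>u\<close> reduces to this case by exchanging the points, which
  flips the signs of \<open>u\<close> and \<open>m\<close>.\<close>

lemma Hoeffdings_lemma_two_point:
  fixes m u :: real
  assumes m: "\<bar>m\<bar> \<le> 1"
  shows "(1 + m) / 2 * exp (u * (1 - m)) + (1 - m) / 2 * exp (u * (- 1 - m)) \<le> exp (u\<^sup>2 / 2)"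
proof -
  have nonneg: "(1 + m) / 2 * exp (u * (1 - m)) + (1 - m) / 2 * exp (u * (- 1 - m)) \<le> exp (u\<^sup>2 / 2)"
    if u: "u \<ge> 0" and m: "\<bar>m\<bar> \<le> 1" for u m :: real
  proof -
    define r where "r = (1 + m) / 2"
    have r: "0 \<le> r" using m by (auto simp: r_def)
    have pos: "0 < 1 + r * (exp (2 * u) - 1)"
      using r u by (intro add_pos_nonneg mult_nonneg_nonneg) auto
    have "- (2 * u) * r + ln (1 + r * (exp (2 * u) - 1)) \<le> (2 * u)\<^sup>2 / 8"
      using Hoeffdings_lemma_aux[of "2 * u" r] r u by simp
    then have "exp (- (2 * u) * r + ln (1 + r * (exp (2 * u) - 1))) \<le> exp (u\<^sup>2 / 2)"
      by (simp add: power2_eq_square)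
    then have "exp (- (2 * u) * r) * (1 + r * (exp (2 * u) - 1)) \<le> exp (u\<^sup>2 / 2)"
      using pos by (simp only: exp_add exp_ln)
    also have "exp (- (2 * u) * r) * (1 + r * (exp (2 * u) - 1)) =
        (1 - r) * exp (- (2 * u) * r) + r * exp (- (2 * u) * r + 2 * u)"
      unfolding exp_add by (simp add: algebra_simps)
    also have "- (2 * u) * r + 2 * u = u * (1 - m)" by (simp add: r_def field_simps)
    also have "- (2 * u) * r = u * (- 1 - m)" by (simp add: r_def field_simps)
    also have "1 - r = (1 - m) / 2" by (simp add: r_def field_simps)
    finally show ?thesis by (simp add: r_def)
  qed
  show ?thesis
  proof (cases "u \<ge> 0")
    case True
    then show ?thesis using nonneg m by blast
  next
    case False
    then have "(1 + - m) / 2 * exp (- u * (1 - - m)) + (1 - - m) / 2 * exp (- u * (- 1 - - m))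
        \<le> exp ((- u)\<^sup>2 / 2)"
      using m by (intro nonneg) auto
    then show ?thesis by (simp add: algebra_simps)
  qed
qed

section \<open>Integrals over an event independent of a random variable\<close>

text \<open>By independence, the law of \<open>f\<close> under \<open>M\<close> restricted to
  \<open>A\<close> is its law under \<open>M\<close> scaled by \<open>prob A\<close>. Integrating
  against these two equal measures settles all \<open>g\<close> at once.\<close>

lemma (in prob_space) nn_integral_indep_indicator:
  assumes f: "f \<in> M \<rightarrow>\<^sub>M N" and A: "A \<in> \<A>" "A \<in> events"
    and indep: "indep_set (gen_sigma M N f) \<A>"
    and g: "g \<in> borel_measurable N"
  shows "(\<integral>\<^sup>+\<omega>. g (f \<omega>) * indicator A \<omega> \<partial>M) = ennreal (prob A) * (\<integral>\<^sup>+\<omega>. g (f \<omega>) \<partial>M)"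
proof -
  have "distr (density M (indicator A)) N f = scale_measure (ennreal (prob A)) (distr M N f)"
  proof (rule measure_eqI)
    fix C assume "C \<in> sets (distr (density M (indicator A)) N f)"
    then have C: "C \<in> sets N" by simp
    have meas: "f -` C \<inter> space M \<in> events" using f C by (rule measurable_sets)
    have "prob ((f -` C \<inter> space M) \<inter> A) = prob (f -` C \<inter> space M) * prob A"
      using C A by (intro indep_setD[OF indep]) (auto simp: gen_sigma_def in_vimage_algebra)
    then have "emeasure M (A \<inter> (f -` C \<inter> space M)) =
        ennreal (prob A) * emeasure M (f -` C \<inter> space M)"
      by (simp add: emeasure_eq_measure ennreal_mult' mult.commute Int_commute)
    then show "emeasure (distr (density M (indicator A)) N f) C =
        emeasure (scale_measure (ennreal (prob A)) (distr M N f)) C"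
      using f C A meas
      by (simp add: emeasure_distr emeasure_density nn_integral_set_ennreal flip: indicator_inter_arith)
  qed simp
  then have "nn_integral (distr (density M (indicator A)) N f) g =
      nn_integral (scale_measure (ennreal (prob A)) (distr M N f)) g"
    by simp
  moreover have "(\<lambda>\<omega>. g (f \<omega>)) \<in> borel_measurable M" using f g by simp
  ultimately show ?thesis
    using f g A
    by (simp add: nn_integral_distr nn_integral_scale_measure nn_integral_density mult.commute)
qed

section \<open>The martingale and the estimation error\<close>

text \<open>Each \<open>X (k + 1)\<close> is centred by its conditional mean. The process is an
  argument so that the coordinate maps of the product space of past steps can be substituted for it.
  Only steps up to time \<open>n\<close> enter, as the summand for \<open>k\<close> stops at step
  \<open>k + 1\<close>.\<close>

definition erw_mart :: "real \<Rightarrow> (nat \<Rightarrow> 'a \<Rightarrow> real) \<Rightarrow> nat \<Rightarrow> 'a \<Rightarrow> real" where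
  "erw_mart p X n \<omega> =
    (\<Sum>k=1..n-1. erw_S X k \<omega> / real k * (X (k + 1) \<omega> - (2 * p - 1) * (erw_S X k \<omega> / real k)))"

lemma erw_mart_Suc:
  assumes "n \<ge> 1"
  shows "erw_mart p X (n + 1) \<omega> = erw_mart p X n \<omega> +
    erw_S X n \<omega> / real n * (X (n + 1) \<omega> - (2 * p - 1) * (erw_S X n \<omega> / real n))"
proof -
  obtain m where "n = Suc m" using assms by (cases n) auto
  then show ?thesis by (simp add: erw_mart_def)
qed

lemma erw_S_measurable:
  assumes "\<And>i. i \<in> {1..n} \<Longrightarrow> X i \<in> borel_measurable M"
  shows "erw_S X n \<in> borel_measurable M"
proof -
  have "(\<lambda>\<omega>. \<Sum>i=1..n. X i \<omega>) \<in> borel_measurable M"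
    using assms by (intro borel_measurable_sum) auto
  then show ?thesis by (simp add: erw_S_def[abs_def])
qed

lemma erw_mart_measurable:
  assumes X: "\<And>i. i \<in> {1..n} \<Longrightarrow> X i \<in> borel_measurable M"
  shows "erw_mart p X n \<in> borel_measurable M"
proof -
  have "(\<lambda>\<omega>. \<Sum>k=1..n-1. erw_S X k \<omega> / real k *
      (X (k + 1) \<omega> - (2 * p - 1) * (erw_S X k \<omega> / real k))) \<in> borel_measurable M"
  proof (intro borel_measurable_sum)
    fix k assume k: "k \<in> {1..n-1}"
    have [measurable]: "erw_S X k \<in> borel_measurable M"
      using k by (intro erw_S_measurable X) auto
    have [measurable]: "X (k + 1) \<in> borel_measurable M"
      using k by (intro X) auto
    show "(\<lambda>\<omega>. erw_S X k \<omega> / real k *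
      (X (k + 1) \<omega> - (2 * p - 1) * (erw_S X k \<omega> / real k))) \<in> borel_measurable M"
      by measurable
  qed
  then show ?thesis by (simp add: erw_mart_def[abs_def])
qed

text \<open>With \<open>s\<close> for the ratio at \<open>k\<close>, writing
  \<open>X (k + 1) + s\<close> as \<open>(X (k + 1) - (2 * p - 1) * s) + 2 * p * s\<close> splits
  the numerator of the estimator into the martingale and \<open>2 * p * Q\<close>. The hypothesis
  excludes division by zero, which would make the estimator 0.\<close>

lemma erw_p_hat_error:
  assumes "erw_V X n \<omega> \<noteq> 0"
  shows "erw_p_hat X n \<omega> - p = 2 * erw_mart p X n \<omega> / erw_V X n \<omega>"
proof -
  let ?s = "\<lambda>k. erw_S X k \<omega> / real k"
  define Q where "Q = (\<Sum>k=1..n-1. (?s k)\<^sup>2)"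
  have Q: "Q \<noteq> 0" using assms by (simp add: erw_V_def Q_def)
  have "(\<Sum>k=1..n-1. ?s k * (X (k + 1) \<omega> + ?s k)) =
      (\<Sum>k=1..n-1. ?s k * (X (k + 1) \<omega> - (2 * p - 1) * ?s k) + 2 * p * (?s k)\<^sup>2)"
    by (intro sum.cong refl) algebra
  also have "\<dots> = erw_mart p X n \<omega> + 2 * p * Q"
    by (simp add: sum.distrib erw_mart_def Q_def sum_distrib_left)
  finally have "erw_p_hat X n \<omega> = (erw_mart p X n \<omega> + 2 * p * Q) / (2 * Q)"
    unfolding erw_p_hat_def Q_def by simp
  moreover have "erw_V X n \<omega> = 4 * Q" by (simp add: erw_V_def Q_def)
  ultimately show ?thesis using Q by (simp add: field_simps)
qed

section \<open>The past of the walk and the range of its steps\<close>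

context elephant_random_walk
begin

text \<open>The restriction makes this a point of the product space, and the body is literally the
  vector in \<open>indep_past\<close>, which can thus be folded.\<close>

definition past :: "nat \<Rightarrow> 'a \<Rightarrow> nat \<Rightarrow> real" where
  "past n \<omega> = (\<lambda>i\<in>{1..n}. X i \<omega>)"

lemma past_measurable: "past n \<in> M \<rightarrow>\<^sub>M PiM {1..n} (\<lambda>_. borel)"
  unfolding past_def[abs_def] by (intro measurable_restrict X_measurable) auto

text \<open>Used to express functionals of the walk up to time \<open>n\<close> as functions of the
  past vector, with coordinate maps in place of \<open>X\<close>.\<close>

lemma erw_S_past: "k \<le> n \<Longrightarrow> erw_S (\<lambda>i y. y i) k (past n \<omega>) = erw_S X k \<omega>"
  by (auto simp: erw_S_def past_def intro!: sum.cong)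

lemma erw_mart_past: "erw_mart p' (\<lambda>i y. y i) n (past n \<omega>) = erw_mart p' X n \<omega>"
  unfolding erw_mart_def
proof (intro sum.cong refl)
  fix k assume "k \<in> {1..n-1}"
  then have k: "k \<le> n" "k + 1 \<in> {1..n}" by auto
  then have "past n \<omega> (k + 1) = X (k + 1) \<omega>" by (simp only: past_def restrict_apply if_True)
  with k(1) show "erw_S (\<lambda>i y. y i) k (past n \<omega>) / real k *
      (past n \<omega> (k + 1) - (2 * p' - 1) * (erw_S (\<lambda>i y. y i) k (past n \<omega>) / real k)) =
      erw_S X k \<omega> / real k * (X (k + 1) \<omega> - (2 * p' - 1) * (erw_S X k \<omega> / real k))"
    by (simp only: erw_S_past)
qed

text \<open>The \<open>n\<close> disjoint events \<open>K n = k\<close>, each of mass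
  \<open>1 / n\<close>, exhaust the total mass.\<close>

lemma AE_K_range:
  assumes n: "n \<ge> 1"
  shows "AE \<omega> in M. K n \<omega> \<in> {1..n}"
proof -
  have [measurable]: "K n \<in> M \<rightarrow>\<^sub>M count_space UNIV" using n by (rule K_measurable)
  have "prob {\<omega> \<in> space M. K n \<omega> \<in> {1..n}} = prob (\<Union>k\<in>{1..n}. {\<omega> \<in> space M. K n \<omega> = k})"
    by (intro arg_cong[where f = prob]) auto
  also have "\<dots> = (\<Sum>k=1..n. prob {\<omega> \<in> space M. K n \<omega> = k})"
    by (intro finite_measure_finite_Union) (auto simp: disjoint_family_on_def)
  also have "\<dots> = (\<Sum>k=1..n. 1 / real n)"
    using n by (intro sum.cong K_uniform) auto
  also have "\<dots> = 1" using n by simp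
  finally show ?thesis using AE_prob_1 by fastforce
qed

text \<open>A step is a recalled one up to sign, and the recalled index may be any earlier one,
  hence strong induction. For the first step the masses \<open>q\<close> and \<open>1 - q\<close>
  add up to 1.\<close>

lemma AE_X_sign:
  assumes "n \<ge> 1"
  shows "AE \<omega> in M. X n \<omega> = 1 \<or> X n \<omega> = - 1"
  using assms
proof (induction n rule: less_induct)
  case (less n)
  show ?case
  proof (cases "n = 1")
    case True
    have [measurable]: "X 1 \<in> borel_measurable M" by (rule X_measurable) simp
    have "{\<omega> \<in> space M. X 1 \<omega> = 1} \<in> events" "{\<omega> \<in> space M. X 1 \<omega> = - 1} \<in> events"
      by measurable
    note sets = this
    have "prob {\<omega> \<in> space M. X 1 \<omega> = 1 \<or> X 1 \<omega> = - 1} =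
        prob ({\<omega> \<in> space M. X 1 \<omega> = 1} \<union> {\<omega> \<in> space M. X 1 \<omega> = - 1})"
      by (intro arg_cong[where f = prob]) auto
    also have "\<dots> = 1"
      using first_step_plus first_step_minus by (subst finite_measure_Union[OF sets]) auto
    finally show ?thesis unfolding True using AE_prob_1 by fastforce
  next
    case False
    define m where "m = n - 1"
    have m: "m \<ge> 1" "n = m + 1" using False less.prems by (auto simp: m_def)
    \<comment> \<open>The quantifier over \<open>k\<close> stands inside \<open>AE\<close>, so it
      can be instantiated with the random index \<open>K m\<close>.\<close>
    have "AE \<omega> in M. \<forall>k\<in>{1..m}. X k \<omega> = 1 \<or> X k \<omega> = - 1"
      using less.IH m by (intro AE_finite_allI) auto
    then show ?thesis
      using AE_K_range[OF m(1)] step[OF m(1)] by eventually_elim (auto simp: m(2))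
  qed
qed

lemma AE_past_sign: "AE \<omega> in M. \<forall>k\<in>{1..n}. X k \<omega> = 1 \<or> X k \<omega> = - 1"
  by (intro AE_finite_allI AE_X_sign) auto

section \<open>The law of the next step given the past\<close>

lemma prob_K_B:
  assumes n: "n \<ge> 1" and k: "k \<in> {1..n}"
  shows "prob {\<omega> \<in> space M. K n \<omega> = k \<and> B n \<omega> = b} = (if b then p else 1 - p) / real n"
proof -
  have [measurable]: "B n \<in> M \<rightarrow>\<^sub>M count_space UNIV" using n by (rule B_measurable)
  have B: "prob {\<omega> \<in> space M. B n \<omega> = b} = (if b then p else 1 - p)"
    using B_bernoulli[OF n] prob_neg[of "B n"] by (cases b) auto
  have "prob ((K n -` {k} \<inter> space M) \<inter> (B n -` {b} \<inter> space M)) =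
      prob (K n -` {k} \<inter> space M) * prob (B n -` {b} \<inter> space M)"
    by (intro indep_setD[OF indep_K_B[OF n]]) (auto simp: gen_sigma_def intro!: in_vimage_algebra)
  also have "K n -` {k} \<inter> space M = {\<omega> \<in> space M. K n \<omega> = k}" by auto
  also have "B n -` {b} \<inter> space M = {\<omega> \<in> space M. B n \<omega> = b}" by auto
  also have "{\<omega> \<in> space M. K n \<omega> = k} \<inter> {\<omega> \<in> space M. B n \<omega> = b} =
      {\<omega> \<in> space M. K n \<omega> = k \<and> B n \<omega> = b}" by auto
  finally show ?thesis using K_uniform[OF n k] B by simp
qed

text \<open>The event is the preimage of the rectangle \<open>{k} \<times> {b}\<close> under the
  pair \<open>(K n, B n)\<close>, which is independent of the past.\<close>

lemma nn_integral_past_K_B: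
  assumes n: "n \<ge> 1" and k: "k \<in> {1..n}"
    and g: "g \<in> borel_measurable (PiM {1..n} (\<lambda>_. borel))"
  shows "(\<integral>\<^sup>+\<omega>. g (past n \<omega>) * indicator {\<omega> \<in> space M. K n \<omega> = k \<and> B n \<omega> = b} \<omega> \<partial>M) =
    ennreal ((if b then p else 1 - p) / real n) * (\<integral>\<^sup>+\<omega>. g (past n \<omega>) \<partial>M)"
proof -
  let ?A = "{\<omega> \<in> space M. K n \<omega> = k \<and> B n \<omega> = b}"
  have [measurable]: "B n \<in> M \<rightarrow>\<^sub>M count_space UNIV" using n by (rule B_measurable)
  have [measurable]: "K n \<in> M \<rightarrow>\<^sub>M count_space UNIV" using n by (rule K_measurable)
  have "{k} \<times> {b} \<in> sets (count_space UNIV \<Otimes>\<^sub>M count_space UNIV)"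
    by (intro pair_measureI) auto
  then have "(\<lambda>\<omega>. (K n \<omega>, B n \<omega>)) -` ({k} \<times> {b}) \<inter> space M
      \<in> gen_sigma M (count_space UNIV \<Otimes>\<^sub>M count_space UNIV) (\<lambda>\<omega>. (K n \<omega>, B n \<omega>))"
    unfolding gen_sigma_def by (rule in_vimage_algebra)
  also have "(\<lambda>\<omega>. (K n \<omega>, B n \<omega>)) -` ({k} \<times> {b}) \<inter> space M = ?A" by auto
  finally have A: "?A \<in> gen_sigma M (count_space UNIV \<Otimes>\<^sub>M count_space UNIV) (\<lambda>\<omega>. (K n \<omega>, B n \<omega>))" .
  have "?A \<in> events" by measurable
  from nn_integral_indep_indicator[OF past_measurable A this
      indep_past[OF n, folded past_def] g]
  show ?thesis by (simp add: prob_K_B[OF n k])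
qed

text \<open>
  The conditional law of the next step given the past, integrated against a function of both,
  which avoids conditional expectations.
\<close>

lemma nn_integral_step:
  assumes n: "n \<ge> 1"
    and F: "case_prod F \<in> borel_measurable (borel \<Otimes>\<^sub>M PiM {1..n} (\<lambda>_. borel))"
  shows "(\<integral>\<^sup>+\<omega>. F (X (n + 1) \<omega>) (past n \<omega>) \<partial>M) =
    (\<integral>\<^sup>+\<omega>. (\<Sum>k=1..n. ennreal (p / real n) * F (X k \<omega>) (past n \<omega>) +
      ennreal ((1 - p) / real n) * F (- X k \<omega>) (past n \<omega>)) \<partial>M)"
proof -
  let ?I = "\<lambda>k b. indicator {\<omega> \<in> space M. K n \<omega> = k \<and> B n \<omega> = b} :: 'a \<Rightarrow> ennreal"
  \<comment> \<open>The value of \<open>F\<close> when step \<open>k\<close> is recalled with coin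
    value \<open>b\<close>: a function of the past alone, so that independence applies.\<close>
  let ?G = "\<lambda>k b y. F (if b then y k else - y k) y"
  have [measurable]: "B n \<in> M \<rightarrow>\<^sub>M count_space UNIV" using n by (rule B_measurable)
  have [measurable]: "K n \<in> M \<rightarrow>\<^sub>M count_space UNIV" using n by (rule K_measurable)
  have [measurable]: "past n \<in> M \<rightarrow>\<^sub>M PiM {1..n} (\<lambda>_. borel)" by (rule past_measurable)
  have G [measurable]: "?G k b \<in> borel_measurable (PiM {1..n} (\<lambda>_. borel))" if k: "k \<in> {1..n}" for k b
  proof -
    have c: "(\<lambda>y. y k) \<in> borel_measurable (PiM {1..n} (\<lambda>_. borel :: real measure))"
      using k by (rule measurable_component_singleton)
    have "(\<lambda>y. if b then y k else - y k) \<in> borel_measurable (PiM {1..n} (\<lambda>_. borel :: real measure))"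
      using c borel_measurable_uminus[OF c] by (cases b) (simp_all only: if_True if_False)
    then have "(\<lambda>y. (if b then y k else - y k, y)) \<in>
        PiM {1..n} (\<lambda>_. borel :: real measure) \<rightarrow>\<^sub>M borel \<Otimes>\<^sub>M PiM {1..n} (\<lambda>_. borel)"
      by (intro measurable_Pair measurable_ident_sets refl)
    from measurable_compose[OF this F] show ?thesis by simp
  qed
  have GM [measurable]: "(\<lambda>\<omega>. ?G k b (past n \<omega>)) \<in> borel_measurable M" if "k \<in> {1..n}" for k b
    using measurable_compose[OF past_measurable G[OF that]] by simp
  have coin: "(\<integral>\<^sup>+\<omega>. ?G k b (past n \<omega>) * ?I k b \<omega> \<partial>M) =
      ennreal ((if b then p else 1 - p) / real n) * (\<integral>\<^sup>+\<omega>. ?G k b (past n \<omega>) \<partial>M)"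
    if "k \<in> {1..n}" for k b
    by (rule nn_integral_past_K_B[OF n that G[OF that]])
  have past_k: "past n \<omega> k = X k \<omega>" if "k \<in> {1..n}" for k \<omega>
    using that by (simp add: past_def)
  have "(\<integral>\<^sup>+\<omega>. F (X (n + 1) \<omega>) (past n \<omega>) \<partial>M) =
      (\<integral>\<^sup>+\<omega>. (\<Sum>k=1..n. ?G k True (past n \<omega>) * ?I k True \<omega> + ?G k False (past n \<omega>) * ?I k False \<omega>) \<partial>M)"
  proof (rule nn_integral_cong_AE)
    show "AE \<omega> in M. F (X (n + 1) \<omega>) (past n \<omega>) =
        (\<Sum>k=1..n. ?G k True (past n \<omega>) * ?I k True \<omega> + ?G k False (past n \<omega>) * ?I k False \<omega>)"
      using AE_K_range[OF n] step[OF n] AE_space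
    proof eventually_elim
      case (elim \<omega>)
      \<comment> \<open>Of the \<open>2 * n\<close> indicators, only the one for the realised pair
        \<open>(K n \<omega>, B n \<omega>)\<close> is nonzero at \<open>\<omega>\<close>.\<close>
      have "(\<Sum>k=1..n. ?G k True (past n \<omega>) * ?I k True \<omega> + ?G k False (past n \<omega>) * ?I k False \<omega>) =
          (\<Sum>k=1..n. if k = K n \<omega> then ?G k (B n \<omega>) (past n \<omega>) else 0)"
        using elim by (intro sum.cong refl) (auto simp: indicator_def)
      also have "\<dots> = ?G (K n \<omega>) (B n \<omega>) (past n \<omega>)"
        using elim by (subst sum.delta) auto
      finally show ?case
        using elim by (simp add: past_k)
    qed
  qed
  also have "\<dots> = (\<Sum>k=1..n. (\<integral>\<^sup>+\<omega>. ?G k True (past n \<omega>) * ?I k True \<omega> \<partial>M) +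
      (\<integral>\<^sup>+\<omega>. ?G k False (past n \<omega>) * ?I k False \<omega> \<partial>M))"
    by (subst nn_integral_sum, measurable, intro sum.cong refl nn_integral_add, measurable)
  \<comment> \<open>Independence turns each indicator into its probability; afterwards the integrals
    are reassembled into one.\<close>
  also have "\<dots> = (\<Sum>k=1..n. ennreal (p / real n) * (\<integral>\<^sup>+\<omega>. ?G k True (past n \<omega>) \<partial>M) +
      ennreal ((1 - p) / real n) * (\<integral>\<^sup>+\<omega>. ?G k False (past n \<omega>) \<partial>M))"
    by (intro sum.cong refl arg_cong2[where f = "(+)"])
       (use coin[of _ True] coin[of _ False] in simp_all)
  also have "\<dots> = (\<integral>\<^sup>+\<omega>. (\<Sum>k=1..n. ennreal (p / real n) * ?G k True (past n \<omega>) +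
      ennreal ((1 - p) / real n) * ?G k False (past n \<omega>)) \<partial>M)"
    by (subst nn_integral_sum, measurable, intro sum.cong refl, subst nn_integral_add, measurable,
        simp add: nn_integral_cmult GM[of _ True, simplified] GM[of _ False, simplified])
  also have "\<dots> = (\<integral>\<^sup>+\<omega>. (\<Sum>k=1..n. ennreal (p / real n) * F (X k \<omega>) (past n \<omega>) +
      ennreal ((1 - p) / real n) * F (- X k \<omega>) (past n \<omega>)) \<partial>M)"
    by (intro nn_integral_cong sum.cong refl) (simp add: past_k)
  finally show ?thesis .
qed

section \<open>Exponential moments of the martingale\<close>

text \<open>For a sign \<open>y\<close>, the mixture \<open>p * h y + (1 - p) * h (- y)\<close> puts
  mass \<open>(1 + (2 * p - 1) * y) / 2\<close> on 1 and the rest on -1. This is affine in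
  \<open>y\<close>, so averaging over \<open>k\<close> replaces \<open>y\<close> by \<open>s\<close>
  and gives the law of a sign with mean \<open>m\<close>. The two-point lemma applies to it at
  \<open>t * s\<close>.\<close>

lemma sum_exp_step_le:
  fixes x :: "nat \<Rightarrow> real" and d t :: real
  assumes n: "n \<ge> 1" and x: "\<And>k. k \<in> {1..n} \<Longrightarrow> x k = 1 \<or> x k = - 1"
  defines "s \<equiv> (\<Sum>k=1..n. x k) / real n"
  defines "h \<equiv> (\<lambda>y. exp (t * (d + s * (y - (2 * p - 1) * s))))"
  shows "(\<Sum>k=1..n. p / real n * h (x k) + (1 - p) / real n * h (- x k)) \<le> exp (t\<^sup>2 / 2) * exp (t * d)"
proof -
  define m where "m = (2 * p - 1) * s"
  have "\<bar>\<Sum>k=1..n. x k\<bar> \<le> (\<Sum>k=1..n. \<bar>x k\<bar>)" by (rule sum_abs)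
  also have "\<dots> \<le> (\<Sum>k=1..n. 1)" using x by (intro sum_mono) fastforce
  finally have s: "\<bar>s\<bar> \<le> 1" using n by (simp add: s_def field_simps)
  have "\<bar>2 * p - 1\<bar> \<le> 1" using p_range by auto
  with s have m: "\<bar>m\<bar> \<le> 1" by (simp add: m_def abs_mult mult_le_one)
  have lin: "(\<Sum>k=1..n. c0 + c1 * x k) / real n = c0 + c1 * s" for c0 c1
    unfolding sum.distrib sum_distrib_left[symmetric] s_def using n by (simp add: field_simps)
  have "(\<Sum>k=1..n. p / real n * h (x k) + (1 - p) / real n * h (- x k)) =
      (\<Sum>k=1..n. ((1 + (2 * p - 1) * x k) / 2 * h 1 + (1 - (2 * p - 1) * x k) / 2 * h (- 1)) / real n)"
  proof (intro sum.cong refl)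
    fix k assume "k \<in> {1..n}"
    from x[OF this] show "p / real n * h (x k) + (1 - p) / real n * h (- x k) =
        ((1 + (2 * p - 1) * x k) / 2 * h 1 + (1 - (2 * p - 1) * x k) / 2 * h (- 1)) / real n"
      by (elim disjE) (simp_all add: add_divide_distrib diff_divide_distrib algebra_simps)
  qed
  also have "\<dots> = (\<Sum>k=1..n. (h 1 + h (- 1)) / 2 + (2 * p - 1) * (h 1 - h (- 1)) / 2 * x k) / real n"
    unfolding sum_divide_distrib
    by (intro sum.cong refl arg_cong2[where f = "(/)"]) (simp add: field_simps)
  also have "\<dots> = (h 1 + h (- 1)) / 2 + (2 * p - 1) * (h 1 - h (- 1)) / 2 * s"
    by (rule lin)
  also have "\<dots> = (1 + m) / 2 * h 1 + (1 - m) / 2 * h (- 1)"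
    unfolding m_def by (simp add: field_simps)
  also have "h 1 = exp (t * d) * exp (t * s * (1 - m))"
    by (simp add: h_def m_def flip: exp_add) (simp add: algebra_simps)
  also have "h (- 1) = exp (t * d) * exp (t * s * (- 1 - m))"
    by (simp add: h_def m_def flip: exp_add) (simp add: algebra_simps)
  also have "(1 + m) / 2 * (exp (t * d) * exp (t * s * (1 - m))) +
      (1 - m) / 2 * (exp (t * d) * exp (t * s * (- 1 - m))) =
      exp (t * d) * ((1 + m) / 2 * exp (t * s * (1 - m)) + (1 - m) / 2 * exp (t * s * (- 1 - m)))"
    by (simp add: algebra_simps)
  also have "\<dots> \<le> exp (t * d) * exp ((t * s)\<^sup>2 / 2)"
    by (intro mult_left_mono Hoeffdings_lemma_two_point m) simp
  \<comment> \<open>The weight \<open>s\<close> is at most 1 in modulus, so the bound can be made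
    free of the past.\<close>
  also have "(t * s)\<^sup>2 \<le> t\<^sup>2"
  proof -
    have "s\<^sup>2 \<le> 1" using s by (simp add: abs_square_le_1)
    then show ?thesis by (simp add: power_mult_distrib mult_left_le)
  qed
  finally show ?thesis by (simp add: mult.commute)
qed

lemma erw_mart_measurable_M: "erw_mart p X n \<in> borel_measurable M"
  by (intro erw_mart_measurable X_measurable) auto

text \<open>Induction on the number \<open>m\<close> of increments, each of which costs a factor
  \<open>exp (t\<^sup>2 / 2)\<close>. Time \<open>m + 1\<close> carries exactly \<open>m\<close> of
  them, so the base case is an empty sum. The sign of \<open>t\<close> is free, which serves both
  tails.\<close>

lemma nn_integral_exp_mart:
  "(\<integral>\<^sup>+\<omega>. ennreal (exp (t * erw_mart p X (m + 1) \<omega>)) \<partial>M) \<le> ennreal (exp (real m * t\<^sup>2 / 2))"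
proof (induction m)
  case 0
  show ?case by (simp add: erw_mart_def emeasure_space_1)
next
  case (Suc m)
  define n where "n = m + 1"
  have n: "n \<ge> 1" by (simp add: n_def)
  \<comment> \<open>The exponential at time \<open>n + 1\<close> as a function of the next step
    \<open>x\<close> and the past vector \<open>y\<close>, the form that
    \<open>nn_integral_step\<close> averages.\<close>
  define F where "F = (\<lambda>x y. ennreal (exp (t * (erw_mart p (\<lambda>i y. y i) n y +
    erw_S (\<lambda>i y. y i) n y / real n * (x - (2 * p - 1) * (erw_S (\<lambda>i y. y i) n y / real n))))))"
  have [measurable]: "erw_mart p (\<lambda>i y. y i) n \<in> borel_measurable (PiM {1..n} (\<lambda>_. borel))"
    by (intro erw_mart_measurable measurable_component_singleton)
  have [measurable]: "erw_S (\<lambda>i y. y i) n \<in> borel_measurable (PiM {1..n} (\<lambda>_. borel))"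
    by (intro erw_S_measurable measurable_component_singleton)
  have F: "case_prod F \<in> borel_measurable (borel \<Otimes>\<^sub>M PiM {1..n} (\<lambda>_. borel))"
    unfolding F_def by measurable
  have F_past: "F x (past n \<omega>) = ennreal (exp (t * (erw_mart p X n \<omega> +
      (\<Sum>k=1..n. X k \<omega>) / real n * (x - (2 * p - 1) * ((\<Sum>k=1..n. X k \<omega>) / real n)))))" for x \<omega>
    by (simp add: F_def erw_mart_past erw_S_past) (simp add: erw_S_def)
  have "(\<integral>\<^sup>+\<omega>. ennreal (exp (t * erw_mart p X (n + 1) \<omega>)) \<partial>M) =
      (\<integral>\<^sup>+\<omega>. F (X (n + 1) \<omega>) (past n \<omega>) \<partial>M)"
    by (intro nn_integral_cong) (simp only: F_past erw_mart_Suc[OF n] erw_S_def)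
  also have "\<dots> = (\<integral>\<^sup>+\<omega>. (\<Sum>k=1..n. ennreal (p / real n) * F (X k \<omega>) (past n \<omega>) +
      ennreal ((1 - p) / real n) * F (- X k \<omega>) (past n \<omega>)) \<partial>M)"
    by (rule nn_integral_step[OF n F])
  also have "\<dots> \<le> (\<integral>\<^sup>+\<omega>. ennreal (exp (t\<^sup>2 / 2)) * ennreal (exp (t * erw_mart p X n \<omega>)) \<partial>M)"
  proof (rule nn_integral_mono_AE)
    show "AE \<omega> in M. (\<Sum>k=1..n. ennreal (p / real n) * F (X k \<omega>) (past n \<omega>) +
        ennreal ((1 - p) / real n) * F (- X k \<omega>) (past n \<omega>))
        \<le> ennreal (exp (t\<^sup>2 / 2)) * ennreal (exp (t * erw_mart p X n \<omega>))"
      using AE_past_sign[of n]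
    proof eventually_elim
      case (elim \<omega>)
      \<comment> \<open>Nonnegative weights let the real inequality \<open>sum_exp_step_le\<close>
        pass to \<open>ennreal\<close>.\<close>
      have p: "0 \<le> p / real n" "0 \<le> (1 - p) / real n" using p_range by auto
      show ?case
        unfolding F_past
        using sum_exp_step_le[OF n, of "\<lambda>k. X k \<omega>" t "erw_mart p X n \<omega>"] elim p
        by (simp add: sum_nonneg flip: ennreal_mult ennreal_plus
            del: mult_minus_left times_divide_eq_left times_divide_eq_right)
    qed
  qed
  also have "\<dots> = ennreal (exp (t\<^sup>2 / 2)) * (\<integral>\<^sup>+\<omega>. ennreal (exp (t * erw_mart p X n \<omega>)) \<partial>M)"
    using erw_mart_measurable_M by (intro nn_integral_cmult) simp
  also have "\<dots> \<le> ennreal (exp (t\<^sup>2 / 2)) * ennreal (exp (real m * t\<^sup>2 / 2))"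
    using Suc.IH by (intro mult_left_mono) (auto simp: n_def)
  also have "\<dots> = ennreal (exp (real (Suc m) * t\<^sup>2 / 2))"
    by (simp add: add_divide_distrib algebra_simps flip: ennreal_mult exp_add)
  finally show ?case by (simp add: n_def)
qed

section \<open>Tail bound and confidence intervals\<close>

lemma erw_mart_tail:
  assumes n: "n \<ge> 1" and c: "c > 0" and sg: "sg = 1 \<or> sg = - 1"
  shows "prob {\<omega> \<in> space M. sg * erw_mart p X n \<omega> \<ge> c} \<le> exp (- c\<^sup>2 / (2 * real n))"
proof -
  \<comment> \<open>This minimises the Chernoff exponent
    \<open>real n * s\<^sup>2 / 2 - s * c\<close>, with minimum
    \<open>- c\<^sup>2 / (2 * real n)\<close>.\<close>
  define s where "s = c / real n"
  have s: "s > 0" using n c by (simp add: s_def)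
  have [measurable]: "erw_mart p X n \<in> borel_measurable M" by (rule erw_mart_measurable_M)
  have "emeasure M {\<omega> \<in> space M. sg * erw_mart p X n \<omega> \<ge> c} \<le> ennreal (exp (- s * c)) *
      (\<integral>\<^sup>+\<omega>. ennreal (exp (s * (sg * erw_mart p X n \<omega>))) * indicator (space M) \<omega> \<partial>M)"
    by (intro Chernoff_ineq_nn_integral_ge s) measurable
  also have "(\<integral>\<^sup>+\<omega>. ennreal (exp (s * (sg * erw_mart p X n \<omega>))) * indicator (space M) \<omega> \<partial>M) =
      (\<integral>\<^sup>+\<omega>. ennreal (exp (s * sg * erw_mart p X (n - 1 + 1) \<omega>)) \<partial>M)"
    using n by (intro nn_integral_cong) (simp add: mult.assoc)
  also have "\<dots> \<le> ennreal (exp (real (n - 1) * (s * sg)\<^sup>2 / 2))"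
    by (rule nn_integral_exp_mart)
  \<comment> \<open>The square of \<open>sg\<close> is 1, and the \<open>n - 1\<close> increments
    are counted as \<open>n\<close>.\<close>
  also have "\<dots> \<le> ennreal (exp (real n * s\<^sup>2 / 2))"
    using sg by (intro ennreal_leI) (auto simp: mult_right_mono)
  also have "ennreal (exp (- s * c)) * ennreal (exp (real n * s\<^sup>2 / 2)) =
      ennreal (exp (- c\<^sup>2 / (2 * real n)))"
    using n by (simp add: s_def field_simps power2_eq_square flip: ennreal_mult exp_add)
  finally show ?thesis
    by (simp add: emeasure_eq_measure mult_left_mono)
qed

text \<open>The summand for \<open>k = 1\<close>, present because \<open>n \<ge> 2\<close>, is
  \<open>(X 1 \<omega>)\<^sup>2\<close>, which is 1 almost surely.\<close>

lemma AE_erw_V_pos: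
  assumes n: "n \<ge> 2"
  shows "AE \<omega> in M. erw_V X n \<omega> > 0"
  using AE_X_sign[of 1, simplified]
proof eventually_elim
  case (elim \<omega>)
  have "0 < (\<Sum>k=1..n-1. (erw_S X k \<omega> / real k)\<^sup>2)"
    using n elim by (intro sum_pos2[where i = 1]) (auto simp: erw_S_def)
  then show ?case by (simp add: erw_V_def)
qed

text \<open>The random \<open>erw_V\<close> divides both the error and the half-width and cancels:
  almost surely, \<open>p\<close> is missed only if the martingale exceeds \<open>r / 2\<close> in
  modulus. Each of the two tails has mass at most \<open>exp (- r\<^sup>2 / (8 * real n))\<close>,
  hence at most \<open>\<alpha> / 2\<close> by the bound on \<open>r\<close>.\<close>

lemma exact_confidence_interval_erw:
  assumes \<alpha>: "0 < \<alpha>" "\<alpha> < 1" and n: "n \<ge> 2"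
    and r: "r > 0" "r\<^sup>2 \<ge> 8 * real n * ln (2 / \<alpha>)"
  shows "exact_confidence_interval M p (1 - \<alpha>)
    (\<lambda>\<omega>. {erw_p_hat X n \<omega> - r / erw_V X n \<omega> .. erw_p_hat X n \<omega> + r / erw_V X n \<omega>})"
proof -
  have S [measurable]: "erw_S X k \<in> borel_measurable M" for k
    by (intro erw_S_measurable X_measurable) auto
  have X [measurable]: "X (k + 1) \<in> borel_measurable M" for k
    by (rule X_measurable) simp
  have [measurable]: "erw_p_hat X n \<in> borel_measurable M"
    unfolding erw_p_hat_def[abs_def]
    by (intro borel_measurable_divide borel_measurable_sum borel_measurable_times
        borel_measurable_add borel_measurable_power borel_measurable_const S X)
  have [measurable]: "erw_V X n \<in> borel_measurable M"
    unfolding erw_V_def[abs_def] by measurable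
  have [measurable]: "erw_mart p X n \<in> borel_measurable M" by (rule erw_mart_measurable_M)
  let ?bad = "\<lambda>sg. {\<omega> \<in> space M. sg * erw_mart p X n \<omega> \<ge> r / 2}"
  let ?good = "{\<omega> \<in> space M. p \<in> {erw_p_hat X n \<omega> - r / erw_V X n \<omega> .. erw_p_hat X n \<omega> + r / erw_V X n \<omega>}}"
  have bad: "prob (?bad sg) \<le> \<alpha> / 2" if "sg = 1 \<or> sg = - 1" for sg
  proof -
    have "prob (?bad sg) \<le> exp (- (r / 2)\<^sup>2 / (2 * real n))"
      using n r that by (intro erw_mart_tail) auto
    also have "\<dots> \<le> exp (- ln (2 / \<alpha>))"
      using n r by (simp add: field_simps power2_eq_square)
    also have "\<dots> = \<alpha> / 2" using \<alpha> by (simp add: exp_minus)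
    finally show ?thesis .
  qed
  \<comment> \<open>The implication can fail only where \<open>erw_V\<close> is zero, which is a
    null event.\<close>
  have "AE \<omega> in M. \<omega> \<in> space M - (?bad 1 \<union> ?bad (- 1)) \<longrightarrow> \<omega> \<in> ?good"
    using AE_erw_V_pos[OF n]
  proof eventually_elim
    case (elim \<omega>)
    show ?case
    proof
      assume "\<omega> \<in> space M - (?bad 1 \<union> ?bad (- 1))"
      then have \<omega>: "\<omega> \<in> space M" and D: "\<bar>2 * erw_mart p X n \<omega>\<bar> \<le> r" by auto
      have "\<bar>erw_p_hat X n \<omega> - p\<bar> \<le> r / erw_V X n \<omega>"
        using elim D erw_p_hat_error[of X n \<omega> p] by (simp add: divide_right_mono)
      with \<omega> show "\<omega> \<in> ?good" by auto
    qed
  qed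
  then have "prob (space M - (?bad 1 \<union> ?bad (- 1))) \<le> prob ?good"
    by (rule finite_measure_mono_AE) (simp only: atLeastAtMost_iff, measurable)
  moreover have "prob (space M - (?bad 1 \<union> ?bad (- 1))) = 1 - prob (?bad 1 \<union> ?bad (- 1))"
    by (rule prob_compl) measurable
  moreover have "prob (?bad 1 \<union> ?bad (- 1)) \<le> prob (?bad 1) + prob (?bad (- 1))"
    by (rule measure_Un_le) measurable
  ultimately have "1 - \<alpha> \<le> prob ?good" using bad[of 1] bad[of "- 1"] by linarith
  moreover have "(\<lambda>\<omega>. erw_p_hat X n \<omega> - r / erw_V X n \<omega>) \<in> borel_measurable M"
    "(\<lambda>\<omega>. erw_p_hat X n \<omega> + r / erw_V X n \<omega>) \<in> borel_measurable M"
    by measurable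
  ultimately show ?thesis
    unfolding exact_confidence_interval_def by fast
qed

end

theorem theorem3p11:
  fixes M :: "'a measure"
    and q p \<alpha> :: real
    and X :: "nat \<Rightarrow> 'a \<Rightarrow> real"
    and K :: "nat \<Rightarrow> 'a \<Rightarrow> nat"
    and B :: "nat \<Rightarrow> 'a \<Rightarrow> bool"
    and n :: nat
  assumes erw: "elephant_random_walk M q p X K B"
    and \<alpha>: "0 < \<alpha>" "\<alpha> < 1"
    and n: "n \<ge> 2"
  shows "exact_confidence_interval M p (1 - \<alpha>) (erw_J X n \<alpha>) \<and>
    (1/4 \<le> p \<and> p < 3/4 \<longrightarrow>
      exact_confidence_interval M p (1 - \<alpha>) (erw_K X n \<alpha>) \<and>
      (AE \<omega> in M. erw_K X n \<alpha> \<omega> \<subset> erw_J X n \<alpha> \<omega>))"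
proof -
  interpret elephant_random_walk M q p X K B by (rule erw)
  define L where "L = real n * ln (2 / \<alpha>)"
  have L: "L > 0" using \<alpha> n by (simp add: L_def)
  define rJ where "rJ = 2 * sqrt (3 * real n * ln (2 / \<alpha>))"
  define rK where "rK = sqrt (29 * real n * ln (2 / \<alpha>)) / sqrt 3"
  have rJ: "rJ = sqrt (12 * L)"
    using real_sqrt_mult[of 4 "3 * L"] by (simp add: rJ_def L_def mult.assoc)
  have rK: "rK = sqrt (29 / 3 * L)"
    by (simp add: rK_def L_def mult.assoc flip: real_sqrt_divide)
  have rKJ: "0 < rK" "rK < rJ" using L by (simp_all add: rJ rK)
  \<comment> \<open>Here \<open>rJ\<^sup>2 = 12 * L\<close> and
    \<open>rK\<^sup>2 = 29 / 3 * L\<close>, and both constants exceed the required 8.\<close>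
  have sq: "rJ\<^sup>2 \<ge> 8 * real n * ln (2 / \<alpha>)" "rK\<^sup>2 \<ge> 8 * real n * ln (2 / \<alpha>)"
    using L unfolding rJ rK by (simp_all add: L_def)
  have J: "erw_J X n \<alpha> = (\<lambda>\<omega>. {erw_p_hat X n \<omega> - rJ / erw_V X n \<omega> ..
      erw_p_hat X n \<omega> + rJ / erw_V X n \<omega>})"
    by (simp add: fun_eq_iff erw_J_def rJ_def)
  have K: "erw_K X n \<alpha> = (\<lambda>\<omega>. {erw_p_hat X n \<omega> - rK / erw_V X n \<omega> ..
      erw_p_hat X n \<omega> + rK / erw_V X n \<omega>})"
    by (simp add: fun_eq_iff erw_K_def rK_def)
  have "exact_confidence_interval M p (1 - \<alpha>) (erw_J X n \<alpha>)"
    "exact_confidence_interval M p (1 - \<alpha>) (erw_K X n \<alpha>)"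
    unfolding J K using \<alpha> n rKJ sq by (intro exact_confidence_interval_erw; simp)+
  \<comment> \<open>Strictness is an almost sure statement: where \<open>erw_V\<close> is zero, both
    intervals collapse to the point estimate.\<close>
  moreover have "AE \<omega> in M. erw_K X n \<alpha> \<omega> \<subset> erw_J X n \<alpha> \<omega>"
    using AE_erw_V_pos[OF n]
  proof eventually_elim
    case (elim \<omega>)
    then have "0 < rK / erw_V X n \<omega>" "rK / erw_V X n \<omega> < rJ / erw_V X n \<omega>"
      using rKJ by (simp_all add: divide_strict_right_mono)
    then show ?case unfolding J K by (subst atLeastatMost_psubset_iff) auto
  qed
  ultimately show ?thesis by blast
qed

end
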